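(* Let $n>2$, let $\Phi:[0,1]_{\mathbb D}\to\mathbb D^{+}$ be an admissible hyperbolic generator, and let $\mathcal N_\Phi:\mathcal P_{\mathbb D}(n)\to\mathcal P_{\mathbb D}(n)$ be the hyperbolic negator generated by $\Phi$. Suppose that, for every $P=(p_1,\ldots,p_n)\in\mathcal P_{\mathbb D}(n)$, every active idempotent component $\ell\in\{1,2\}$ of $P$, and all $i,j\in\{1,\ldots,n\}$, \[ p_j^{(\ell)}=1\ \Longrightarrow\ \Phi^{(\ell)}(p_j)=0, \] and \[ p_i^{(\ell)}\le p_j^{(\ell)}<1\ \Longrightarrow\ \Phi^{(\ell)}(p_i)\ge\Phi^{(\ell)}(p_j)\ \text{ and }\ \frac{\Phi^{(\ell)}(p_i)}{1-p_i^{(\ell)}}\le\frac{\Phi^{(\ell)}(p_j)}{1-p_j^{(\ell)}}. \] For $P\in\mathcal P_{\mathbb D}(n)$, let $P_m=\mathcal N_\Phi^m(P)=(p_{m,1},\ldots,p_{m,n})$ be the $m$-th iterate of $\mathcal N_\Phi$ applied to $P$. Then \[ \lim_{m\to\infty}p_{m,j}^{(\ell)}=\frac{s^{(\ell)}(P)}{n} \] for every $j=1,\ldots,n$ and every $\ell\in\{1,2\}$.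
   Context: Hyperbolic numbers: $\mathbb D=\{a+\mathbf k b: a,b\in\mathbb R\}$ with $\mathbf k^2=1$, $\mathbf e_1=(1+\mathbf k)/2$, $\mathbf e_2=(1-\mathbf k)/2$. Every $z\in\mathbb D$ is uniquely $z=z^{(1)}\mathbf e_1+z^{(2)}\mathbf e_2$ with $z^{(1)},z^{(2)}\in\mathbb R$; addition and multiplication are component-wise in these coordinates, and $1=\mathbf e_1+\mathbf e_2$. Partial order: $z\preceq_{\mathbb D}w$ iff $z^{(1)}\le w^{(1)}$ and $z^{(2)}\le w^{(2)}$. $\mathbb D^{+}=\{z: 0\preceq_{\mathbb D}z\}$ and $[0,1]_{\mathbb D}=\{z: 0\preceq_{\mathbb D}z\preceq_{\mathbb D}1\}$. Distributions: $\mathcal P_{\mathbb D}(n)$ is the set of $P=(p_1,\ldots,p_n)\in\mathbb D^n$ with all $p_j\in[0,1]_{\mathbb D}$ and $s(P):=\sum_j p_j\in\{1,\mathbf e_1,\mathbf e_2\}$. Write $p_j=p_j^{(1)}\mathbf e_1+p_j^{(2)}\mathbf e_2$, $s^{(\ell)}(P)=\sum_j p_j^{(\ell)}\in\{0,1\}$. Component $\ell$ of $P$ is active if $s^{(\ell)}(P)=1$ and inactive if $s^{(\ell)}(P)=0$. Generators: a map $\Phi=\Phi^{(1)}\mathbf e_1+\Phi^{(2)}\mathbf e_2:[0,1]_{\mathbb D}\to\mathbb D^{+}$ is an admissible hyperbolic generator (for the given $n$) if (i) $z\preceq_{\mathbb D}w$ implies $\Phi(w)\preceq_{\mathbb D}\Phi(z)$,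 and (ii) for every $P\in\mathcal P_{\mathbb D}(n)$ and every active component $\ell$ of $P$, $Z_\ell^\Phi(P):=\sum_{j=1}^n\Phi^{(\ell)}(p_j)>0$. The generated negator is $\mathcal N_\Phi(P)=(q_1,\ldots,q_n)$ with $q_j^{(\ell)}=\Phi^{(\ell)}(p_j)/Z_\ell^\Phi(P)$ if component $\ell$ of $P$ is active, and $q_j^{(\ell)}=0$ if it is inactive. *)

theory Defs
  imports "HOL-Analysis.Analysis"
begin

datatype hyperbolic = Hyp (hre: real) (him: real)

lemma hyperbolic_eq_iff: "z = w \<longleftrightarrow> hre z = hre w \<and> him z = him w"
  by (cases z; cases w) simp

instantiation hyperbolic :: real_algebra_1
begin

definition "0 = Hyp 0 0"
definition "1 = Hyp 1 0"
definition "z + w = Hyp (hre z + hre w) (him z + him w)"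
definition "- z = Hyp (- hre z) (- him z)"
definition "z - w = Hyp (hre z - hre w) (him z - him w)"
definition "z * w = Hyp (hre z * hre w + him z * him w) (hre z * him w + him z * hre w)"
definition "r *\<^sub>R z = Hyp (r * hre z) (r * him z)"

instance
  by standard
    (simp_all add: hyperbolic_eq_iff zero_hyperbolic_def one_hyperbolic_def plus_hyperbolic_def
      uminus_hyperbolic_def minus_hyperbolic_def times_hyperbolic_def scaleR_hyperbolic_def
      algebra_simps)

end

instance hyperbolic :: comm_ring_1
proof
  show "z * w = w * z" for z w :: hyperbolic
    unfolding times_hyperbolic_def by (simp add: mult.commute add.commute)
qed (rule mult_1_left distrib_right)+

definition hyp_k :: hyperbolic where
  "hyp_k = Hyp 0 1"

lemma hyp_k_squared: "hyp_k * hyp_k = 1"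
  by (simp add: hyp_k_def times_hyperbolic_def one_hyperbolic_def)

lemma hyperbolic_eq_re_im: "z = of_real (hre z) + hyp_k * of_real (him z)"
  unfolding of_real_def hyp_k_def times_hyperbolic_def one_hyperbolic_def
    plus_hyperbolic_def scaleR_hyperbolic_def by simp

definition hyp_e1 :: hyperbolic where
  "hyp_e1 = (1 + hyp_k) /\<^sub>R 2"

definition hyp_e2 :: hyperbolic where
  "hyp_e2 = (1 - hyp_k) /\<^sub>R 2"

datatype idem_index = I1 | I2

(* a + k b = (a + b) e1 + (a - b) e2 *)
fun hcomp :: "idem_index \<Rightarrow> hyperbolic \<Rightarrow> real" where
  "hcomp I1 z = hre z + him z"
| "hcomp I2 z = hre z - him z"

lemma hyperbolic_decomposition_iff:
  "z = x *\<^sub>R hyp_e1 + y *\<^sub>R hyp_e2 \<longleftrightarrow> x = hcomp I1 z \<and> y = hcomp I2 z"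
  by (auto simp: hyperbolic_eq_iff hyp_e1_def hyp_e2_def hyp_k_def one_hyperbolic_def
      plus_hyperbolic_def minus_hyperbolic_def scaleR_hyperbolic_def field_simps)

lemma hcomp_decomposition: "hcomp I1 z *\<^sub>R hyp_e1 + hcomp I2 z *\<^sub>R hyp_e2 = z"
  by (rule sym) (simp add: hyperbolic_decomposition_iff del: hcomp.simps)

lemma hcomp_combination [simp]:
  "hcomp I1 (x *\<^sub>R hyp_e1 + y *\<^sub>R hyp_e2) = x"
  "hcomp I2 (x *\<^sub>R hyp_e1 + y *\<^sub>R hyp_e2) = y"
  using hyperbolic_decomposition_iff by metis+

lemma hcomp_zero [simp]: "hcomp l 0 = 0"
  by (cases l) (simp_all add: zero_hyperbolic_def)

lemma hcomp_one [simp]: "hcomp l 1 = 1"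
  by (cases l) (simp_all add: one_hyperbolic_def)

lemma hcomp_add [simp]: "hcomp l (z + w) = hcomp l z + hcomp l w"
  by (cases l) (simp_all add: plus_hyperbolic_def)

lemma hcomp_mult [simp]: "hcomp l (z * w) = hcomp l z * hcomp l w"
  by (cases l) (simp_all add: times_hyperbolic_def algebra_simps)

lemma hcomp_sum: "hcomp l (sum f A) = (\<Sum>x\<in>A. hcomp l (f x))"
  by (induction A rule: infinite_finite_induct) simp_all

lemma hcomp_e1 [simp]: "hcomp I1 hyp_e1 = 1" "hcomp I2 hyp_e1 = 0"
  using hcomp_combination[of 1 0] by simp_all

lemma hcomp_e2 [simp]: "hcomp I1 hyp_e2 = 0" "hcomp I2 hyp_e2 = 1"
  using hcomp_combination[of 0 1] by simp_all

lemma hyperbolic_eqI: "hcomp I1 z = hcomp I1 w \<Longrightarrow> hcomp I2 z = hcomp I2 w \<Longrightarrow> z = w"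
  by (subst (1 2) hcomp_decomposition[symmetric]) (simp only:)

instantiation hyperbolic :: order
begin

definition "z \<le> w \<longleftrightarrow> hcomp I1 z \<le> hcomp I1 w \<and> hcomp I2 z \<le> hcomp I2 w"
definition "z < w \<longleftrightarrow> z \<le> w \<and> \<not> w \<le> (z :: hyperbolic)"

instance
  by standard
    (auto simp: less_eq_hyperbolic_def less_hyperbolic_def simp del: hcomp.simps
      intro: hyperbolic_eqI)

end

lemma hyperbolic_le_iff: "z \<le> w \<longleftrightarrow> (\<forall>l. hcomp l z \<le> hcomp l w)"
  unfolding less_eq_hyperbolic_def by (metis idem_index.exhaust)

definition hdist_total :: "hyperbolic ^ 'n \<Rightarrow> hyperbolic" where
  "hdist_total P = (\<Sum>j\<in>UNIV. P $ j)"

definition hdist :: "(hyperbolic ^ 'n) set" where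
  "hdist = {P. (\<forall>j. P $ j \<in> {0..1}) \<and> hdist_total P \<in> {1, hyp_e1, hyp_e2}}"

definition active :: "idem_index \<Rightarrow> hyperbolic ^ 'n \<Rightarrow> bool" where
  "active l P \<longleftrightarrow> hcomp l (hdist_total P) = 1"

definition neg_norm :: "(hyperbolic \<Rightarrow> hyperbolic) \<Rightarrow> idem_index \<Rightarrow> hyperbolic ^ 'n \<Rightarrow> real" where
  "neg_norm \<Phi> l P = (\<Sum>j\<in>UNIV. hcomp l (\<Phi> (P $ j)))"

(* The type argument carries the length n = CARD('n); only the values of \<Phi> on {0..1} matter. *)
definition admissible_generator :: "'n::finite itself \<Rightarrow> (hyperbolic \<Rightarrow> hyperbolic) \<Rightarrow> bool" where
  "admissible_generator _ \<Phi> \<longleftrightarrow>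
     \<Phi> \<in> {0..1} \<rightarrow> {0..} \<and>
     antimono_on {0..1} \<Phi> \<and>
     (\<forall>P \<in> (hdist :: (hyperbolic ^ 'n) set). \<forall>l. active l P \<longrightarrow> neg_norm \<Phi> l P > 0)"

definition neg_comp ::
  "(hyperbolic \<Rightarrow> hyperbolic) \<Rightarrow> hyperbolic ^ 'n \<Rightarrow> 'n \<Rightarrow> idem_index \<Rightarrow> real" where
  "neg_comp \<Phi> P j l = (if active l P then hcomp l (\<Phi> (P $ j)) / neg_norm \<Phi> l P else 0)"

definition negator :: "(hyperbolic \<Rightarrow> hyperbolic) \<Rightarrow> hyperbolic ^ 'n \<Rightarrow> hyperbolic ^ 'n" where
  "negator \<Phi> P = (\<chi> j. neg_comp \<Phi> P j I1 *\<^sub>R hyp_e1 + neg_comp \<Phi> P j I2 *\<^sub>R hyp_e2)"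

lemma hcomp_negator: "hcomp l (negator \<Phi> P $ j) = neg_comp \<Phi> P j l"
  by (cases l) (simp_all add: negator_def del: hcomp.simps hcomp_add)

lemma hdist_total_component:
  assumes "P \<in> hdist" shows "hcomp l (hdist_total P) = (if active l P then 1 else 0)"
  using assms by (cases l) (auto simp: hdist_def active_def simp del: hcomp.simps)

lemma negator_in_hdist:
  fixes P :: "hyperbolic ^ 'n"
  assumes adm: "admissible_generator TYPE('n) \<Phi>" and P: "P \<in> hdist"
  shows "negator \<Phi> P \<in> hdist" and "hdist_total (negator \<Phi> P) = hdist_total P"
proof -
  have nonneg: "0 \<le> hcomp l (\<Phi> (P $ j))" for l j
  proof -
    have "P $ j \<in> {0..1}" using P by (simp add: hdist_def)
    then have "\<Phi> (P $ j) \<in> {0..}" using adm by (auto simp: admissible_generator_def)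
    then show ?thesis by (simp add: hyperbolic_le_iff)
  qed
  have pos: "neg_norm \<Phi> l P > 0" if "active l P" for l
    using adm P that by (auto simp: admissible_generator_def)
  have le: "hcomp l (\<Phi> (P $ j)) \<le> neg_norm \<Phi> l P" for l j
    unfolding neg_norm_def by (rule member_le_sum) (auto simp: nonneg)
  have total: "hcomp l (hdist_total (negator \<Phi> P)) = hcomp l (hdist_total P)" for l
  proof -
    have "hcomp l (hdist_total (negator \<Phi> P)) = (\<Sum>j\<in>UNIV. neg_comp \<Phi> P j l)"
      by (simp add: hdist_total_def hcomp_sum hcomp_negator)
    also have "\<dots> = (if active l P then 1 else 0)"
      using pos[of l]
      by (auto simp: neg_comp_def simp flip: sum_divide_distrib neg_norm_def)
    finally show ?thesis using hdist_total_component[OF P] by simp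
  qed
  then show eq: "hdist_total (negator \<Phi> P) = hdist_total P"
    by (intro hyperbolic_eqI)
  have "negator \<Phi> P $ j \<in> {0..1}" for j
    by (simp add: hyperbolic_le_iff hcomp_negator neg_comp_def nonneg le pos less_imp_le)
  then show "negator \<Phi> P \<in> hdist"
    using P eq by (simp add: hdist_def)
qed

end

theory Submission
  imports Defs
begin

text \<open>
  Fix an active component and let \<open>a\<close> be an index where it is smallest, with ratio
  \<open>\<rho> = \<Phi>(p\<^sub>a) / (1 - p\<^sub>a)\<close>. The hypotheses give \<open>\<rho> (1 - p\<^sub>j) \<le> \<Phi>(p\<^sub>j) \<le> \<Phi>(p\<^sub>a)\<close> for all \<open>j\<close>.
  Hence the normaliser is at least \<open>\<rho> (n - 1)\<close>, while two generator values differ by at most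
  \<open>\<rho>\<close> times the spread of \<open>P\<close>. So every step shrinks the spread by the factor \<open>1 / (n - 1) < 1\<close>,
  and as the total stays 1, all entries tend to \<open>1 / n\<close>.
\<close>

text \<open>One active component is treated as a plain real vector. \<open>D\<close> may be any
  bound on the spread rather than the spread itself, so that a geometric bound can be fed back in at
  each iteration.\<close>

lemma normalised_spread_contraction:
  fixes x \<phi> :: "'n::finite \<Rightarrow> real"
  assumes card: "CARD('n) \<ge> 2"
    and total: "(\<Sum>j\<in>UNIV. x j) = 1"
    and le1: "\<And>j. x j \<le> 1"
    and nonneg: "\<And>j. \<phi> j \<ge> 0"
    and pos: "(\<Sum>j\<in>UNIV. \<phi> j) > 0"
    and zero: "\<And>j. x j = 1 \<Longrightarrow> \<phi> j = 0"
    and mono: "\<And>i j. x i \<le> x j \<Longrightarrow> x j < 1 \<Longrightarrow>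
      \<phi> i \<ge> \<phi> j \<and> \<phi> i / (1 - x i) \<le> \<phi> j / (1 - x j)"
    and spread: "\<And>i k. x i - x k \<le> D"
  shows "\<phi> i / (\<Sum>j\<in>UNIV. \<phi> j) - \<phi> k / (\<Sum>j\<in>UNIV. \<phi> j) \<le> D / (real CARD('n) - 1)"
proof -
  define Z where "Z = (\<Sum>j\<in>UNIV. \<phi> j)"
  have "Min (range x) \<in> range x" by (rule Min_in) auto
  then obtain a where a: "x a = Min (range x)" by (metis imageE)
  have xa: "x a \<le> x j" for j unfolding a by (rule Min_le) auto
  \<comment> \<open>This keeps the denominator of \<rho> nonzero. If the minimum were 1, all entries
    would be 1 and the total would be CARD('n) \<ge> 2.\<close>
  have "x a < 1"
  proof (rule ccontr)
    assume "\<not> x a < 1"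
    then have "x j = 1" for j using xa[of j] le1[of j] by linarith
    then have "(\<Sum>j\<in>UNIV. x j) = real CARD('n)" by simp
    then show False using total card by simp
  qed
  define \<rho> where "\<rho> = \<phi> a / (1 - x a)"
  have \<rho>_nonneg: "\<rho> \<ge> 0" using nonneg[of a] \<open>x a < 1\<close> by (simp add: \<rho>_def)
  have \<phi>a: "\<phi> a = \<rho> * (1 - x a)" using \<open>x a < 1\<close> by (simp add: \<rho>_def)
  \<comment> \<open>\<open>mono\<close> says nothing about entries equal to 1; for those
    \<open>zero\<close> gives \<phi> j = 0.\<close>
  have upper: "\<phi> j \<le> \<phi> a" for j
    using mono[OF xa, of j] zero[of j] le1[of j] nonneg[of a] by fastforce
  have lower: "\<rho> * (1 - x j) \<le> \<phi> j" for j
  proof (cases "x j < 1")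
    case True
    then have "\<rho> \<le> \<phi> j / (1 - x j)" using mono[OF xa] by (simp add: \<rho>_def)
    then show ?thesis using True by (simp add: pos_le_divide_eq)
  next
    case False
    then have "x j = 1" using le1[of j] by linarith
    then show ?thesis using nonneg by simp
  qed
  have "(\<Sum>j\<in>UNIV. \<rho> * (1 - x j)) \<le> Z"
    unfolding Z_def by (rule sum_mono) (rule lower)
  \<comment> \<open>The weights 1 - x j add up to CARD('n) - 1 because the entries of
    \<open>x\<close> add up to 1.\<close>
  then have Z: "\<rho> * (real CARD('n) - 1) \<le> Z"
    by (simp add: sum_subtractf total flip: sum_distrib_left)
  have D: "D \<ge> 0" using spread[of a a] by simp
  have n: "real CARD('n) - 1 > 0" using card by simp
  have "\<phi> i - \<phi> k \<le> \<rho> * (x k - x a)"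
    using upper[of i] lower[of k] \<phi>a by (simp add: algebra_simps)
  also have "\<dots> \<le> \<rho> * D" by (rule mult_left_mono[OF spread \<rho>_nonneg])
  \<comment> \<open>Multiplying by CARD('n) - 1 produces the product \<rho> * (CARD('n) - 1), which
    the normaliser bounds, so \<rho> drops out.\<close>
  finally have "(\<phi> i - \<phi> k) * (real CARD('n) - 1) \<le> \<rho> * D * (real CARD('n) - 1)"
    using n by (simp add: mult_right_mono)
  also have "\<dots> \<le> D * Z" using mult_left_mono[OF Z D] by (simp add: algebra_simps)
  finally have "(\<phi> i - \<phi> k) / Z \<le> D / (real CARD('n) - 1)"
    using n pos by (simp add: divide_le_eq le_divide_eq mult.commute Z_def)
  then show ?thesis by (simp add: Z_def diff_divide_distrib)
qed

text \<open>The deviation of x j from the mean is the average over k of the differences x j - x k,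
  each of which lies between -D and D.\<close>

lemma dist_mean_le_spread:
  fixes x :: "'n::finite \<Rightarrow> real"
  assumes total: "(\<Sum>j\<in>UNIV. x j) = s" and spread: "\<And>i k. x i - x k \<le> D"
  shows "\<bar>x j - s / real CARD('n)\<bar> \<le> D"
proof -
  have n: "real CARD('n) > 0" by simp
  have eq: "(\<Sum>k\<in>UNIV. x j - x k) = real CARD('n) * x j - s"
    by (simp add: sum_subtractf total)
  have "(\<Sum>k\<in>UNIV. x j - x k) \<le> (\<Sum>k\<in>(UNIV::'n set). D)"
    by (rule sum_mono) (rule spread)
  moreover have "(\<Sum>k\<in>(UNIV::'n set). - D) \<le> (\<Sum>k\<in>UNIV. x j - x k)"
  proof (rule sum_mono)
    fix k show "- D \<le> x j - x k" using spread[of k j] by linarith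
  qed
  ultimately have "\<bar>real CARD('n) * x j - s\<bar> \<le> real CARD('n) * D"
    unfolding eq by (simp add: abs_le_iff)
  moreover have "real CARD('n) * x j - s = real CARD('n) * (x j - s / real CARD('n))"
    by (simp add: right_diff_distrib)
  ultimately have "real CARD('n) * \<bar>x j - s / real CARD('n)\<bar> \<le> real CARD('n) * D"
    by (simp add: abs_mult)
  then show ?thesis using n by (rule mult_left_le_imp_le)
qed

theorem theorem5p6:
  fixes \<Phi> :: "hyperbolic \<Rightarrow> hyperbolic"
    and P :: "hyperbolic ^ 'n"
  assumes "CARD('n) > 2"
    and "admissible_generator TYPE('n) \<Phi>"
    and "\<And>(Q :: hyperbolic ^ 'n) l j.
      Q \<in> hdist \<Longrightarrow> active l Q \<Longrightarrow> hcomp l (Q $ j) = 1 \<Longrightarrow> hcomp l (\<Phi> (Q $ j)) = 0"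
    and "\<And>(Q :: hyperbolic ^ 'n) l i j.
      Q \<in> hdist \<Longrightarrow> active l Q \<Longrightarrow> hcomp l (Q $ i) \<le> hcomp l (Q $ j) \<Longrightarrow> hcomp l (Q $ j) < 1 \<Longrightarrow>
      hcomp l (\<Phi> (Q $ i)) \<ge> hcomp l (\<Phi> (Q $ j)) \<and>
      hcomp l (\<Phi> (Q $ i)) / (1 - hcomp l (Q $ i)) \<le> hcomp l (\<Phi> (Q $ j)) / (1 - hcomp l (Q $ j))"
    and "P \<in> hdist"
  shows "\<forall>j l. (\<lambda>m. hcomp l ((negator \<Phi> ^^ m) P $ j))
           \<longlonglongrightarrow> hcomp l (hdist_total P) / real CARD('n)"
proof (intro allI)
  fix j l
  let ?Q = "\<lambda>m. (negator \<Phi> ^^ m) P"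
  let ?n = "real CARD('n)"
  let ?D = "\<lambda>m. (1 / (?n - 1)) ^ m"
  note [simp del] = hcomp.simps
  \<comment> \<open>The hypotheses on \<Phi> can be used at every iterate only because iterates
    remain distributions; the unchanged total keeps the same components active.\<close>
  have inv: "?Q m \<in> hdist \<and> hdist_total (?Q m) = hdist_total P" for m
    using assms(5) negator_in_hdist[OF assms(2)] by (induction m) auto
  have bounds: "0 \<le> hcomp l (?Q m $ i) \<and> hcomp l (?Q m $ i) \<le> 1" for m i
    using inv[of m] by (auto simp: hdist_def hyperbolic_le_iff)
  have total: "(\<Sum>i\<in>UNIV. hcomp l (?Q m $ i)) = hcomp l (hdist_total P)" for m
    using inv[of m] by (simp add: hdist_total_def flip: hcomp_sum)
  show "(\<lambda>m. hcomp l (?Q m $ j)) \<longlonglongrightarrow> hcomp l (hdist_total P) / ?n"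
  proof (cases "active l P")
    case True
    have act: "active l (?Q m)" for m
      using True inv[of m] by (simp add: active_def)
    \<comment> \<open>The bound starts at 1 since entries lie in [0,1]. The pair \<open>i\<close>,
      \<open>k\<close> is generalised because one contraction step uses the bound for all
      pairs.\<close>
    have spread: "hcomp l (?Q m $ i) - hcomp l (?Q m $ k) \<le> ?D m" for m i k
    proof (induction m arbitrary: i k)
      case 0
      then show ?case using bounds[of 0 i] bounds[of 0 k] by simp
    next
      case (Suc m)
      have Q: "?Q m \<in> hdist" using inv by blast
      have \<Phi>_nonneg: "hcomp l (\<Phi> (?Q m $ i)) \<ge> 0" for i
      proof -
        have "?Q m $ i \<in> {0..1}" using Q by (simp add: hdist_def)
        then have "\<Phi> (?Q m $ i) \<in> {0..}"
          using assms(2) by (auto simp: admissible_generator_def)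
        then show ?thesis by (simp add: hyperbolic_le_iff)
      qed
      have "neg_norm \<Phi> l (?Q m) > 0"
        using assms(2) Q act by (auto simp: admissible_generator_def)
      then have "hcomp l (\<Phi> (?Q m $ i)) / neg_norm \<Phi> l (?Q m)
          - hcomp l (\<Phi> (?Q m $ k)) / neg_norm \<Phi> l (?Q m) \<le> ?D m / (?n - 1)"
        unfolding neg_norm_def
        using assms(1) total[of m] True bounds \<Phi>_nonneg assms(3)[OF Q act] assms(4)[OF Q act] Suc
        by (intro normalised_spread_contraction[where x = "\<lambda>i. hcomp l (?Q m $ i)"])
          (auto simp: active_def)
      then show ?case by (simp add: hcomp_negator neg_comp_def act mult.commute)
    qed
    \<comment> \<open>Here CARD('n) > 2 matters: for two entries the factor would be 1.\<close>
    have "?D \<longlonglongrightarrow> 0" using assms(1) by (intro LIMSEQ_power_zero) simp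
    then have "(\<lambda>m. hcomp l (?Q m $ j) - hcomp l (hdist_total P) / ?n) \<longlonglongrightarrow> 0"
      by (rule Lim_null_comparison[rotated])
        (use dist_mean_le_spread[OF total spread] in \<open>simp add: always_eventually\<close>)
    then show ?thesis by (simp add: LIM_zero_iff)
  next
    case False
    \<comment> \<open>In an inactive component nonnegative entries sum to 0 at every iterate, so the
      sequence is constantly 0, as is its claimed limit.\<close>
    then have s: "hcomp l (hdist_total P) = 0"
      using hdist_total_component[OF assms(5), of l] by simp
    then have "hcomp l (?Q m $ j) = 0" for m
      using total[of m] bounds[of m] by (simp add: sum_nonneg_eq_0_iff)
    then show ?thesis by (simp add: s)
  qed
qed

end
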